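(* For every $(a_0,a_1)\in\mathbb{Z}^2$ there exists $\varepsilon>0$ such that for every $\lambda$ with $2-\varepsilon<\lambda<2$, the integer sequence $(a_n)_{n\ge0}$ determined by the initial values $a_0,a_1$ and $$0\le a_{n+2}+\lambda a_{n+1}+a_n<1\qquad(n\ge0)$$ is periodic.
   Context: The condition determines $a_{n+2}\in\mathbb{Z}$ uniquely as $a_{n+2}=-\lfloor \lambda a_{n+1}+a_n\rfloor$. *)

theory Defs
  imports Complex_Main
begin

definition satisfies_recurrence :: "real \<Rightarrow> (nat \<Rightarrow> int) \<Rightarrow> bool" where
  "satisfies_recurrence l a \<longleftrightarrow>
     (\<forall>n. 0 \<le> real_of_int (a (n + 2)) + l * real_of_int (a (n + 1)) + real_of_int (a n) \<and>
          real_of_int (a (n + 2)) + l * real_of_int (a (n + 1)) + real_of_int (a n) < 1)"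

text \<open>Periodicity is pure: there is no pre-period.\<close>

definition periodic_seq :: "(nat \<Rightarrow> 'a) \<Rightarrow> bool" where
  "periodic_seq a \<longleftrightarrow> (\<exists>p>0. \<forall>n. a (n + p) = a n)"

lemma satisfies_recurrence_iff:
  "satisfies_recurrence l a \<longleftrightarrow>
     (\<forall>n. a (n + 2) = - \<lfloor>l * real_of_int (a (n + 1)) + real_of_int (a n)\<rfloor>)"
proof -
  have "(0 \<le> real_of_int z + x + y \<and> real_of_int z + x + y < 1) \<longleftrightarrow> z = - \<lfloor>x + y\<rfloor>"
    for z :: int and x y :: real
    by linarith
  then show ?thesis
    unfolding satisfies_recurrence_def by simp
qed

fun rec_seq :: "real \<Rightarrow> int \<Rightarrow> int \<Rightarrow> nat \<Rightarrow> int" where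
  "rec_seq l x y 0 = x"
| "rec_seq l x y (Suc 0) = y"
| "rec_seq l x y (Suc (Suc n)) =
     - \<lfloor>l * real_of_int (rec_seq l x y (Suc n)) + real_of_int (rec_seq l x y n)\<rfloor>"

lemma recurrence_ex1: "\<exists>!a. a 0 = x \<and> a 1 = y \<and> satisfies_recurrence l a"
proof (rule ex1I[of _ "rec_seq l x y"])
  show "rec_seq l x y 0 = x \<and> rec_seq l x y 1 = y \<and> satisfies_recurrence l (rec_seq l x y)"
    by (simp add: satisfies_recurrence_iff)
next
  fix a assume a: "a 0 = x \<and> a 1 = y \<and> satisfies_recurrence l a"
  have "a n = rec_seq l x y n" for n
    using a by (induction l x y n rule: rec_seq.induct) (simp_all add: satisfies_recurrence_iff)
  then show "a = rec_seq l x y" by blast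
qed

end

theory Submission
  imports Defs
begin

text \<open>
  Write \<open>\<lambda> = 2 - \<delta>\<close>. As long as \<open>\<delta> \<bar>a\<^sub>n\<^sub>+\<^sub>1\<bar> < 1\<close>, the recurrence reads
  \<open>a\<^sub>n\<^sub>+\<^sub>2 = - 2 a\<^sub>n\<^sub>+\<^sub>1 - a\<^sub>n + [a\<^sub>n\<^sub>+\<^sub>1 > 0]\<close>, independently of \<open>\<delta>\<close>. Up to alternating signs this is a
  particle subject to a constant force towards the origin. It has an energy that dominates
  \<open>\<bar>a\<^sub>n\<bar>\<close> and is conserved except when the particle crosses the origin with some speed \<open>s\<close>; there it
  stays inside the interval from \<open>s (s - 1)\<close> (excluded) to \<open>s (s + 1)\<close> (included). Hence every bound of
  the form \<open>w (w + 1)\<close> on the energy persists, and all small \<open>\<delta>\<close> give the same bounded orbit. Since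
  the recurrence can be run backwards, a bounded orbit is purely periodic.
\<close>

text \<open>Up to sign \<open>a + b\<close> is the speed. The first branch equals
  \<open>(a + b)\<^sup>2 - b\<close>, so both are a kinetic term plus a linear potential.\<close>

definition energy :: "int \<Rightarrow> int \<Rightarrow> int" where
  "energy a b = (if a > 0 \<or> b \<le> 0 then a + (a + b) * (a + b - 1) else (a + b)\<^sup>2 - a)"

lemma pronic_nonneg: "0 \<le> s * (s - 1)" for s :: int
  by (cases "s \<le> 0") (simp_all add: mult_nonpos_nonpos)

lemma abs_le_energy: "\<bar>a\<bar> \<le> energy a b"
proof (cases "a > 0 \<or> b > 0")
  case True
  then show ?thesis
    using pronic_nonneg[of "a + b"] by (auto simp: energy_def)
next
  case False
  \<comment> \<open>Hence the energy is at least \<open>a\<^sup>2\<close>, which is at least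
    \<open>- a\<close> for an integer.\<close>
  then have "(- a) * (1 - a) \<le> (- (a + b)) * (1 - (a + b))"
    by (intro mult_mono) simp_all
  with False show ?thesis
    using pronic_nonneg[of "- a"] by (simp add: energy_def algebra_simps)
qed

text \<open>The intervals from \<open>s * (s - 1)\<close> (excluded) to \<open>s * (s + 1)\<close>
  (included) tile the positive integers, so \<open>w * (w + 1)\<close> never cuts through
  one.\<close>

lemma pronic_bound_step:
  fixes s w x y :: int
  assumes "0 \<le> w" "0 < s" "s * (s - 1) < x" "x \<le> w * (w + 1)" "y \<le> s * (s + 1)"
  shows "y \<le> w * (w + 1)"
proof -
  have "s \<le> w"
  proof (rule ccontr)
    assume "\<not> s \<le> w"
    then have "w * (w + 1) \<le> (s - 1) * s"
      using assms by (intro mult_mono) auto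
    with assms show False
      by (simp add: mult.commute)
  qed
  then have "s * (s + 1) \<le> w * (w + 1)"
    using assms by (intro mult_mono) auto
  with assms show ?thesis by simp
qed

lemma energy_step:
  assumes "0 \<le> w" "energy a b \<le> w * (w + 1)"
  shows "energy b (- 2 * b - a + (if b > 0 then 1 else 0)) \<le> w * (w + 1)" (is "?E \<le> _")
proof -
  define s where "s = a + b"
  have b: "b = s - a" by (simp add: s_def)
  \<comment> \<open>For \<open>b \<le> 0\<close> the next term is \<open>a - 2 * s\<close>. The
    third case is thus the crossing: after \<open>a > 0\<close>, either \<open>b > 0\<close>, or
    \<open>b\<close> and the next term are both nonpositive.\<close>
  consider "a \<le> 0" | "a > 0" "s \<le> a" "2 * s < a" | "a > 0" "a < s \<or> s \<le> a \<and> a \<le> 2 * s"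
    by linarith
  then show ?thesis
  proof cases
    case 1
    then have "?E = energy a b"
      by (auto simp: energy_def b algebra_simps power2_eq_square)
    with assms show ?thesis by simp
  next
    case 2
    then have "?E = energy a b"
      by (auto simp: energy_def b algebra_simps power2_eq_square)
    with assms show ?thesis by simp
  next
    case 3
    then have "energy a b = s * (s - 1) + a"
      by (simp add: energy_def s_def)
    with 3 have "0 < s" "s * (s - 1) < energy a b"
      by auto
    moreover have "?E \<le> s * (s + 1)"
    proof (cases "a < s")
      case True
      then have "?E = s * (s - 1) + (s - a)"
        by (simp add: energy_def b algebra_simps)
      with True 3 show ?thesis
        by (simp add: algebra_simps)
    next
      case False
      with 3 have "?E = s * (s - 1) + (3 * s - a)"
        by (simp add: energy_def b algebra_simps)
      with False show ?thesis
        by (simp add: algebra_simps)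
    qed
    ultimately show ?thesis
      using assms pronic_bound_step by blast
  qed
qed

lemma recurrence_near_two:
  assumes rec: "satisfies_recurrence l a" and "l < 2" and small: "(2 - l) * \<bar>a (n + 1)\<bar> < 1"
  shows "a (n + 2) = - 2 * a (n + 1) - a n + (if a (n + 1) > 0 then 1 else 0)"
proof -
  \<comment> \<open>The integer \<open>a (n + 2) + 2 * a (n + 1) + a n\<close> is at least
    \<open>d\<close> and less than \<open>d + 1\<close>: it is 1 if \<open>0 < d < 1\<close> and 0
    if \<open>-1 < d \<le> 0\<close>.\<close>
  define d where "d = (2 - l) * real_of_int (a (n + 1))"
  have "d > 0 \<longleftrightarrow> a (n + 1) > 0"
    using \<open>l < 2\<close> by (simp add: d_def zero_less_mult_iff)
  moreover have "\<bar>d\<bar> < 1"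
    using small \<open>l < 2\<close> by (simp add: d_def abs_mult)
  moreover have "l * real_of_int (a (n + 1)) = 2 * real_of_int (a (n + 1)) - d"
    by (simp add: d_def algebra_simps)
  moreover have "0 \<le> real_of_int (a (n + 2)) + l * real_of_int (a (n + 1)) + real_of_int (a n)"
    and "real_of_int (a (n + 2)) + l * real_of_int (a (n + 1)) + real_of_int (a n) < 1"
    using rec by (auto simp: satisfies_recurrence_def)
  ultimately show ?thesis
    by (cases "a (n + 1) > 0"; simp; linarith)
qed

lemma satisfies_recurrence_determined:
  assumes rec: "satisfies_recurrence l a"
    and eq: "a i = a j" "a (Suc i) = a (Suc j)"
  shows "a (i + n) = a (j + n)"
proof -
  have "a (i + n) = a (j + n) \<and> a (Suc (i + n)) = a (Suc (j + n))"
  proof (induction n)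
    case (Suc n)
    then show ?case
      using rec[unfolded satisfies_recurrence_iff, rule_format, of "i + n"]
        rec[unfolded satisfies_recurrence_iff, rule_format, of "j + n"] by simp
  qed (use eq in simp)
  then show ?thesis ..
qed

text \<open>The recurrence is symmetric in \<open>a\<^sub>n\<close> and \<open>a\<^sub>n\<^sub>+\<^sub>2\<close>, so \<open>a\<^sub>n\<close> is determined by its two successors.\<close>

lemma satisfies_recurrence_determined_backwards:
  assumes rec: "satisfies_recurrence l a"
    and eq: "a (i + n) = a (j + n)" "a (Suc (i + n)) = a (Suc (j + n))"
  shows "a i = a j \<and> a (Suc i) = a (Suc j)"
  using eq
proof (induction n)
  case (Suc n)
  have "a m = - \<lfloor>l * real_of_int (a (m + 1)) + real_of_int (a (m + 2))\<rfloor>" for m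
    using rec[unfolded satisfies_recurrence_def, rule_format, of m] by linarith
  from this[of "i + n"] this[of "j + n"] Suc show ?case by simp
qed simp

lemma bounded_recurrence_periodic:
  assumes rec: "satisfies_recurrence l a" and bound: "\<And>n. \<bar>a n\<bar> \<le> K"
  shows "periodic_seq a"
proof -
  have "range (\<lambda>n. (a n, a (Suc n))) \<subseteq> {-K..K} \<times> {-K..K}"
    using bound by (auto simp: abs_le_iff minus_le_iff)
  then have "finite (range (\<lambda>n. (a n, a (Suc n))))"
    by (rule finite_subset) simp
  then have "\<not> inj (\<lambda>n. (a n, a (Suc n)))"
    using finite_imageD infinite_UNIV_nat by blast
  then obtain i j where "i < j" "a i = a j" "a (Suc i) = a (Suc j)"
    by (auto simp: inj_def) (metis linorder_neqE_nat)
  \<comment> \<open>Running back \<open>i\<close> steps moves the repetition to index 0, leaving no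
    pre-period.\<close>
  then have "a 0 = a (j - i) \<and> a (Suc 0) = a (Suc (j - i))"
    by (intro satisfies_recurrence_determined_backwards[OF rec, of 0 i "j - i"]) auto
  then have "a (n + (j - i)) = a n" for n
    using satisfies_recurrence_determined[OF rec, of 0 "j - i" n] by (simp add: add.commute)
  with \<open>i < j\<close> show ?thesis
    unfolding periodic_seq_def by (intro exI[of _ "j - i"]) simp
qed

theorem theorem4:
  fixes a0 a1 :: int
  shows "\<exists>\<epsilon>>0. \<forall>l::real. 2 - \<epsilon> < l \<and> l < 2 \<longrightarrow>
    (\<forall>a :: nat \<Rightarrow> int. a 0 = a0 \<and> a 1 = a1 \<and> satisfies_recurrence l a \<longrightarrow> periodic_seq a)"
proof -
  define w where "w = energy a0 a1"
  define K where "K = w * (w + 1)"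
  have w: "0 \<le> w"
    using abs_le_energy[of a0 a1] by (simp add: w_def)
  then have K: "0 \<le> K" "w \<le> K"
    by (simp_all add: K_def distrib_left)
  have "periodic_seq a"
    if l: "2 - 1 / (real_of_int K + 1) < l" "l < 2"
      and a: "a 0 = a0" "a 1 = a1" and rec: "satisfies_recurrence l a" for l and a :: "nat \<Rightarrow> int"
  proof (rule bounded_recurrence_periodic[OF rec])
    have "energy (a n) (a (n + 1)) \<le> K" for n
    proof (induction n)
      case 0
      then show ?case using a K by (simp add: w_def)
    next
      case (Suc n)
      let ?c = "- 2 * a (n + 1) - a n + (if a (n + 1) > 0 then 1 else 0)"
      \<comment> \<open>Bounding the energy at the candidate \<open>?c\<close> first bounds
        \<open>a (n + 1)\<close>, and that bound is what identifies \<open>?c\<close> with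
        \<open>a (n + 2)\<close>.\<close>
      have E: "energy (a (n + 1)) ?c \<le> K"
        unfolding K_def using Suc w by (intro energy_step) (simp_all add: K_def)
      then have "\<bar>a (n + 1)\<bar> \<le> K"
        using abs_le_energy order_trans by blast
      then have "(2 - l) * real_of_int \<bar>a (n + 1)\<bar> \<le> (2 - l) * real_of_int K"
        using l by (intro mult_left_mono) simp_all
      also have "\<dots> \<le> (2 - l) * (real_of_int K + 1)"
        using l by simp
      also have "\<dots> < 1"
        using l(1) K by (simp add: field_simps)
      finally have "a (n + 2) = ?c"
        by (intro recurrence_near_two[OF rec l(2)]) simp
      with E show ?case by simp
    qed
    then show "\<bar>a n\<bar> \<le> K" for n
      using abs_le_energy order_trans by blast
  qed
  with K show ?thesis
    by (intro exI[of _ "1 / (real_of_int K + 1)"]) auto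
qed

end
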